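(* There is an absolute constant $c>0$ such that for all $n\ge 2$, every Nullstellensatz proof of infeasibility of the pigeonhole principle system $\mathrm{PHP}_n$ (with $n$ pigeons and $n-1$ holes) has total coefficient size at least $c\, n^{3/4}\left(\frac{2}{\sqrt e}\right)^{n}$; that is, the total coefficient size is $\Omega\!\left(n^{3/4}\left(\frac{2}{\sqrt e}\right)^{n}\right)$.
   Context: Pigeonhole system $\mathrm{PHP}_n$: there are Boolean variables $x_{i,j}$ for $i\in[n]$ (pigeons), $j\in[n-1]$ (holes); write $\bar x_{i,j}=1-x_{i,j}$. The (non-Boolean) axioms are: for each $i\in[n]$, $\prod_{j=1}^{n-1}\bar x_{i,j}=0$; and for each pair of distinct $i_1,i_2\in[n]$ and each $j\in[n-1]$, $x_{i_1,j}x_{i_2,j}=0$. Boolean Nullstellensatz proofs: given Boolean variables $y_1,\dots,y_N$, a monomial is a product $\prod_{a\in S}y_a\prod_{b\in T}(1-y_b)$ with $S,T\subseteq[N]$ disjoint. Given axioms $p_1=0,\dots,p_m=0$, a Nullstellensatz proof of infeasibility is a polynomial identity $1=\sum_{i=1}^m p_iq_i+\sum_{a=1}^N g_a(y_a^2-y_a)$ with polynomials $q_i,g_a$ with real coefficients, where each $q_i$ is given as a real linear combination $q_i=\sum_r c_{ir}r$ of monomials $r$ of the form $\prod_{a\in S}y_a\prod_{b\in T}(1-y_b)$ with $S,T\subseteq[N]$ disjoint. Its total coefficient size is $\sum_{i=1}^m T(q_i)$ where $T(q_i)=\sum_r|c_{ir}|$ (the Boolean axioms $y_a^2-y_a=0$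 are used for free). *)

theory Defs
  imports Complex_Main "HOL-Library.Poly_Mapping"
begin

text \<open>
  Real multivariate polynomials: finitely supported maps from exponent vectors to coefficients,
  with the ring structure (convolution product) of \<^theory>\<open>HOL-Library.Poly_Mapping\<close>.
\<close>

type_synonym 'v rpoly = "('v \<Rightarrow>\<^sub>0 nat) \<Rightarrow>\<^sub>0 real"

definition Var :: "'v \<Rightarrow> 'v rpoly" where
  "Var v = Poly_Mapping.single (Poly_Mapping.single v 1) 1"

definition Const :: "real \<Rightarrow> 'v rpoly" where
  "Const c = Poly_Mapping.single 0 c"

definition indets :: "'v rpoly \<Rightarrow> 'v set" where
  "indets p = (\<Union>m\<in>Poly_Mapping.keys p. Poly_Mapping.keys m)"

definition monomial_shapes :: "'v set \<Rightarrow> ('v set \<times> 'v set) set" where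
  "monomial_shapes V = {(S, T). S \<subseteq> V \<and> T \<subseteq> V \<and> S \<inter> T = {}}"

definition bool_monomial :: "'v set \<times> 'v set \<Rightarrow> 'v rpoly" where
  "bool_monomial = (\<lambda>(S, T). (\<Prod>a\<in>S. Var a) * (\<Prod>b\<in>T. 1 - Var b))"

text \<open>
  A linear combination of monomials is given by its coefficient function on pairs \<open>(S, T)\<close>.
  The same polynomial has several such representations, as the monomials are linearly dependent
  (for instance \<open>1 = y + (1 - y)\<close>), so the size belongs to the representation.
\<close>

definition lin_comb :: "'v set \<Rightarrow> ('v set \<times> 'v set \<Rightarrow> real) \<Rightarrow> 'v rpoly" where
  "lin_comb V c = (\<Sum>r\<in>monomial_shapes V. Const (c r) * bool_monomial r)"

definition coeff_size :: "'v set \<Rightarrow> ('v set \<times> 'v set \<Rightarrow> real) \<Rightarrow> real" where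
  "coeff_size V c = (\<Sum>r\<in>monomial_shapes V. \<bar>c r\<bar>)"

text \<open>
  The variables are the elements of the finite set \<open>V\<close>, the axioms are \<open>p i = 0\<close> for \<open>i\<close> in the
  finite set \<open>I\<close>. A proof consists of the coefficients \<open>c i\<close> representing the multipliers of the
  axioms and of the multipliers \<open>g a\<close> of the Boolean axioms.
\<close>

definition nullstellensatz_proof ::
  "'v set \<Rightarrow> 'i set \<Rightarrow> ('i \<Rightarrow> 'v rpoly) \<Rightarrow> ('i \<Rightarrow> 'v set \<times> 'v set \<Rightarrow> real) \<Rightarrow> ('v \<Rightarrow> 'v rpoly) \<Rightarrow> bool"
where
  "nullstellensatz_proof V I p c g \<longleftrightarrow>
     (\<forall>a\<in>V. indets (g a) \<subseteq> V) \<and>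
     1 = (\<Sum>i\<in>I. p i * lin_comb V (c i)) + (\<Sum>a\<in>V. g a * ((Var a)\<^sup>2 - Var a))"

definition total_coeff_size :: "'v set \<Rightarrow> 'i set \<Rightarrow> ('i \<Rightarrow> 'v set \<times> 'v set \<Rightarrow> real) \<Rightarrow> real" where
  "total_coeff_size V I c = (\<Sum>i\<in>I. coeff_size V (c i))"

definition php_vars :: "nat \<Rightarrow> (nat \<times> nat) set" where
  "php_vars n = {1..n} \<times> {1..n-1}"

datatype php_index = Pigeon nat | Hole nat nat nat

text \<open>
  Both orders of a pair of pigeons index an axiom. The repetition does not affect the least
  possible total coefficient size, as the multipliers of two equal axioms can be added up.
\<close>

definition php_indices :: "nat \<Rightarrow> php_index set" where
  "php_indices n =
     {Pigeon i | i. i \<in> {1..n}} \<union>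
     {Hole i\<^sub>1 i\<^sub>2 j | i\<^sub>1 i\<^sub>2 j. i\<^sub>1 \<in> {1..n} \<and> i\<^sub>2 \<in> {1..n} \<and> i\<^sub>1 \<noteq> i\<^sub>2 \<and> j \<in> {1..n-1}}"

fun php_axiom :: "nat \<Rightarrow> php_index \<Rightarrow> (nat \<times> nat) rpoly" where
  "php_axiom n (Pigeon i) = (\<Prod>j=1..n-1. 1 - Var (i, j))"
| "php_axiom n (Hole i\<^sub>1 i\<^sub>2 j) = Var (i\<^sub>1, j) * Var (i\<^sub>2, j)"

text \<open>The index sets are finite, so none of the sums above over them is zero by convention.\<close>

lemma finite_monomial_shapes: "finite V \<Longrightarrow> finite (monomial_shapes V)"
  by (rule finite_subset[of _ "Pow V \<times> Pow V"]) (auto simp: monomial_shapes_def)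

lemma finite_php_vars: "finite (php_vars n)"
  by (simp add: php_vars_def)

lemma finite_php_indices: "finite (php_indices n)"
proof -
  have "php_indices n = Pigeon ` {1..n} \<union>
      (\<Union>i\<^sub>1\<in>{1..n}. \<Union>i\<^sub>2\<in>{1..n} - {i\<^sub>1}. Hole i\<^sub>1 i\<^sub>2 ` {1..n-1})"
    unfolding php_indices_def by blast
  then show ?thesis
    by simp
qed

end

theory Submission
  imports Defs "HOL-Analysis.Convex" "HOL-Combinatorics.Permutations"
begin

text \<open>
  By duality it suffices to find a linear functional \<open>L\<close> on functions of total assignments
  \<open>x : [n] \<rightarrow> [m]\<close>, \<open>m = n - 1\<close>, with \<open>L 1 = 1\<close> that is tiny on every conjunction implying a
  collision \<open>x a = x b = j\<close>; the pigeon axioms vanish on total assignments. We take the signed measure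
  whose marginal on any \<open>m\<close> pigeons is a uniformly random bijection onto the holes and whose top
  component (orthogonal to all functions of fewer than \<open>n\<close> coordinates) is zero. By
  inclusion-exclusion it is the sum over \<open>T \<subset> [n]\<close> of \<open>(-1)^(n-1-|T|)\<close> times the law of ``random
  injection on \<open>T\<close>, independent uniform holes elsewhere''. Marginals with a collision are zero, so in a
  conjunction \<open>x a = x b = j \<and> (\<forall>i. x i \<in> A i)\<close> the indicator of \<open>A i\<close> may be replaced by its
  centred version \<open>u i\<close>, whose squares sum to at most \<open>m/4\<close>. By Cauchy-Schwarz the expectation of
  \<open>\<Prod>i. u i\<close> under a random bijection is at most \<open>(m * (m/4)^(m-1) / m!) powr (1/2)\<close>, which is
  at most \<open>2 * (sqrt e / 2)^m\<close>. A further factor \<open>3/m\<close> comes from the two colliding pigeons.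
\<close>

subsection \<open>Evaluation of polynomials\<close>

definition eval_mon :: "('v \<Rightarrow> real) \<Rightarrow> ('v \<Rightarrow>\<^sub>0 nat) \<Rightarrow> real" where
  "eval_mon x m = (\<Prod>v\<in>Poly_Mapping.keys m. x v ^ Poly_Mapping.lookup m v)"

definition eval_poly :: "('v \<Rightarrow> real) \<Rightarrow> 'v rpoly \<Rightarrow> real" where
  "eval_poly x p = (\<Sum>m\<in>Poly_Mapping.keys p. Poly_Mapping.lookup p m * eval_mon x m)"

lemma eval_mon_superset:
  assumes "finite K" "Poly_Mapping.keys m \<subseteq> K"
  shows "eval_mon x m = (\<Prod>v\<in>K. x v ^ Poly_Mapping.lookup m v)"
  unfolding eval_mon_def using assms by (intro prod.mono_neutral_left) (auto simp: in_keys_iff)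

lemma eval_mon_add: "eval_mon x (a + b) = eval_mon x a * eval_mon x b"
proof -
  let ?K = "Poly_Mapping.keys a \<union> Poly_Mapping.keys b"
  have "Poly_Mapping.keys (a + b) \<subseteq> ?K" by (rule keys_add)
  then show ?thesis
    by (simp add: eval_mon_superset[of ?K] lookup_add power_add prod.distrib)
qed

text \<open>Cancellation may shrink the support of a sum, so additivity is checked on the union of
  the supports, where absent terms count as zero.\<close>

lemma eval_poly_superset:
  assumes "finite K" "Poly_Mapping.keys p \<subseteq> K"
  shows "eval_poly x p = (\<Sum>m\<in>K. Poly_Mapping.lookup p m * eval_mon x m)"
  unfolding eval_poly_def using assms by (intro sum.mono_neutral_left) (auto simp: in_keys_iff)

lemma eval_poly_add: "eval_poly x (p + q) = eval_poly x p + eval_poly x q"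
proof -
  let ?K = "Poly_Mapping.keys p \<union> Poly_Mapping.keys q"
  have "Poly_Mapping.keys (p + q) \<subseteq> ?K" by (rule keys_add)
  then show ?thesis
    by (simp add: eval_poly_superset[of ?K] lookup_add ring_distribs sum.distrib)
qed

lemma eval_poly_single: "eval_poly x (Poly_Mapping.single m c) = c * eval_mon x m"
  by (simp add: eval_poly_def)

lemma eval_poly_zero [simp]: "eval_poly x 0 = 0"
  by (simp add: eval_poly_def)

lemma eval_poly_one [simp]: "eval_poly x 1 = 1"
  by (simp add: eval_poly_def eval_mon_def)

lemma eval_poly_sum: "eval_poly x (sum f A) = (\<Sum>a\<in>A. eval_poly x (f a))"
  by (induction A rule: infinite_finite_induct) (auto simp: eval_poly_add)

text \<open>With this expansion, multiplicativity of evaluation has to be checked only on single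
  terms.\<close>

lemma poly_eq_sum_single:
  "(p :: 'v rpoly) = (\<Sum>m\<in>Poly_Mapping.keys p. Poly_Mapping.single m (Poly_Mapping.lookup p m))"
proof (rule poly_mapping_eqI)
  fix k
  show "Poly_Mapping.lookup p k = Poly_Mapping.lookup
    (\<Sum>m\<in>Poly_Mapping.keys p. Poly_Mapping.single m (Poly_Mapping.lookup p m)) k"
    by (simp add: lookup_sum lookup_single when_def in_keys_iff)
qed

lemma eval_poly_mult: "eval_poly x (p * q) = eval_poly x p * eval_poly x q"
proof -
  have "p * q = (\<Sum>a\<in>Poly_Mapping.keys p. \<Sum>b\<in>Poly_Mapping.keys q.
      Poly_Mapping.single (a + b) (Poly_Mapping.lookup p a * Poly_Mapping.lookup q b))"
    by (subst poly_eq_sum_single[of p], subst poly_eq_sum_single[of q])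
       (simp add: sum_product mult_single)
  then show ?thesis
    by (simp add: eval_poly_sum eval_poly_single eval_mon_add eval_poly_def[of x p]
        eval_poly_def[of x q] sum_product mult_ac)
qed

lemma eval_poly_uminus: "eval_poly x (- p) = - eval_poly x p"
  using eval_poly_add[of x p "- p"] by simp

lemma eval_poly_diff: "eval_poly x (p - q) = eval_poly x p - eval_poly x q"
  using eval_poly_add[of x p "- q"] by (simp add: eval_poly_uminus)

lemma eval_poly_prod: "eval_poly x (prod f A) = (\<Prod>a\<in>A. eval_poly x (f a))"
  by (induction A rule: infinite_finite_induct) (auto simp: eval_poly_mult)

lemma eval_poly_Var [simp]: "eval_poly x (Var v) = x v"
  by (simp add: Var_def eval_poly_single eval_mon_def)

lemma eval_poly_Const [simp]: "eval_poly x (Const c) = c"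
  by (simp add: Const_def eval_poly_single eval_mon_def)

subsection \<open>A pseudo-distribution on pigeon assignments\<close>

text \<open>
  A bijection from \<open>{1..n} - {e}\<close> to the holes \<open>{1..n - 1}\<close>, extended to a permutation by \<open>e \<mapsto> n\<close>.
\<close>

definition bijs :: "nat \<Rightarrow> nat \<Rightarrow> (nat \<Rightarrow> nat) set" where
  "bijs n e = {\<sigma>. \<sigma> permutes {1..n} \<and> \<sigma> e = n}"

definition avg :: "nat \<Rightarrow> (nat \<Rightarrow> real) \<Rightarrow> real" where
  "avg m g = (\<Sum>h=1..m. g h) / m"

definition missed :: "nat \<Rightarrow> nat set \<Rightarrow> nat" where
  "missed n T = (SOME e. e \<in> {1..n} - T)"

text \<open>
  The restriction to \<open>T\<close> of a uniform element of \<open>bijs n e\<close> is a uniform injection from \<open>T\<close> to the holes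
  for every \<open>e \<notin> T\<close>, so the choice of \<open>missed n T\<close> is immaterial (\<open>sum_bijs_cong\<close>).
\<close>

definition dual :: "nat \<Rightarrow> ((nat \<Rightarrow> nat) \<Rightarrow> real) \<Rightarrow> real" where
  "dual n F = (\<Sum>T\<in>Pow {1..n} - {{1..n}}. (- 1) ^ (n - 1 - card T) *
     ((\<Sum>\<sigma>\<in>bijs n (missed n T). \<Sum>f\<in>{1..n} \<rightarrow>\<^sub>E {1..n - 1}. F (\<lambda>i. if i \<in> T then \<sigma> i else f i))
       / (fact (n - 1) * real (n - 1) ^ n)))"

lemma finite_bijs [simp]: "finite (bijs n e)"
  unfolding bijs_def by (rule finite_subset[OF _ finite_permutations[of "{1..n}"]]) auto

lemma missed_in: "T \<in> Pow {1..n} - {{1..n}} \<Longrightarrow> missed n T \<in> {1..n} - T"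
  unfolding missed_def by (rule someI_ex) auto

section \<open>Changing the omitted pigeon\<close>

text \<open>Precomposing with the involution \<open>transpose e e'\<close> exchanges
  \<open>bijs n e\<close> and \<open>bijs n e'\<close>, because it moves the preimage of the extra
  value \<open>n\<close>.\<close>

lemma sum_bijs_transpose:
  assumes "e \<in> {1..n}" "e' \<in> {1..n}"
  shows "(\<Sum>\<sigma>\<in>bijs n e'. h \<sigma>) = (\<Sum>\<sigma>\<in>bijs n e. h (\<sigma> \<circ> transpose e e'))"
proof (rule sum.reindex_bij_witness[of _ "\<lambda>\<sigma>. \<sigma> \<circ> transpose e e'" "\<lambda>\<sigma>. \<sigma> \<circ> transpose e e'"])
  fix \<sigma> assume "\<sigma> \<in> bijs n e'"
  then show "\<sigma> \<circ> transpose e e' \<in> bijs n e"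
    using assms by (auto simp: bijs_def intro!: permutes_compose permutes_swap_id)
next
  fix \<sigma> assume "\<sigma> \<in> bijs n e"
  then show "\<sigma> \<circ> transpose e e' \<in> bijs n e'"
    using assms by (auto simp: bijs_def intro!: permutes_compose permutes_swap_id)
qed (simp_all add: comp_assoc)

text \<open>The transposition alters a permutation only at \<open>e\<close> and \<open>e'\<close>,
  where \<open>h\<close> does not look.\<close>

lemma sum_bijs_cong:
  assumes "e \<in> {1..n}" "e' \<in> {1..n}"
    and "\<And>\<sigma> \<tau>. (\<And>i. i \<noteq> e \<Longrightarrow> i \<noteq> e' \<Longrightarrow> \<sigma> i = \<tau> i) \<Longrightarrow> h \<sigma> = h \<tau>"
  shows "(\<Sum>\<sigma>\<in>bijs n e'. h \<sigma>) = (\<Sum>\<sigma>\<in>bijs n e. h \<sigma>)"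
  unfolding sum_bijs_transpose[OF assms(1,2)]
  by (intro sum.cong refl assms(3)) (simp add: transpose_def)

text \<open>For \<open>e = n\<close> the extra value is a fixed point, which leaves the permutations
  of the holes; transposition gives the other cases.\<close>

lemma card_bijs:
  assumes "e \<in> {1..n}"
  shows "card (bijs n e) = fact (n - 1)"
proof -
  have "n \<in> {1..n}" using assms by auto
  have "bijs n n = {\<sigma>. \<sigma> permutes {1..n - 1}}"
  proof (intro set_eqI iffI)
    fix \<sigma> assume "\<sigma> \<in> bijs n n"
    then have \<sigma>: "\<sigma> permutes {1..n}" "\<sigma> n = n" by (simp_all add: bijs_def)
    have "\<sigma> permutes {1..n - 1}"
    proof (rule permutes_superset[OF \<sigma>(1)])
      fix x assume "x \<in> {1..n} - {1..n - 1}"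
      then have "x = n" by auto
      then show "\<sigma> x = x" using \<sigma> by simp
    qed
    then show "\<sigma> \<in> {\<sigma>. \<sigma> permutes {1..n - 1}}" by simp
  next
    fix \<sigma> assume "\<sigma> \<in> {\<sigma>. \<sigma> permutes {1..n - 1}}"
    then have \<sigma>: "\<sigma> permutes {1..n - 1}" by simp
    have "n \<notin> {1..n - 1}" using \<open>n \<in> {1..n}\<close> by auto
    then have "\<sigma> n = n" by (rule permutes_not_in[OF \<sigma>])
    moreover have "\<sigma> permutes {1..n}"
      by (rule permutes_subset[OF \<sigma>]) auto
    ultimately show "\<sigma> \<in> bijs n n" by (simp add: bijs_def)
  qed
  then have "card (bijs n n) = fact (n - 1)"
    by (simp add: card_permutations)
  moreover have "card (bijs n e) = card (bijs n n)"
    using sum_bijs_transpose[OF \<open>n \<in> {1..n}\<close> assms, of "\<lambda>_. 1::nat"] by simp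
  ultimately show ?thesis by simp
qed

lemma bijs_range:
  assumes "\<sigma> \<in> bijs n e" "i \<in> {1..n}" "i \<noteq> e"
  shows "\<sigma> i \<in> {1..n - 1}"
proof -
  have p: "\<sigma> permutes {1..n}" "\<sigma> e = n" using assms by (auto simp: bijs_def)
  have "\<sigma> i \<in> {1..n}" using permutes_in_image[OF p(1)] assms(2) by blast
  moreover have "\<sigma> i \<noteq> n" using p assms(3) by (metis permutes_inj injD)
  ultimately show ?thesis by auto
qed

section \<open>Algebra of the functional \<open>dual\<close>\<close>

lemma dual_cong:
  assumes "\<And>x. x \<in> {1..n} \<rightarrow> {1..n - 1} \<Longrightarrow> F x = G x"
  shows "dual n F = dual n G"
  unfolding dual_def
proof (intro sum.cong refl arg_cong2[where f = "(/)"] arg_cong2[where f = "(*)"])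
  fix T \<sigma> f
  assume T: "T \<in> Pow {1..n} - {{1..n}}" and s: "\<sigma> \<in> bijs n (missed n T)"
    and f: "f \<in> {1..n} \<rightarrow>\<^sub>E {1..n - 1}"
  have "(if i \<in> T then \<sigma> i else f i) \<in> {1..n - 1}" if i: "i \<in> {1..n}" for i
  proof (cases "i \<in> T")
    case True
    then have "i \<noteq> missed n T" using missed_in[OF T] by auto
    then show ?thesis using bijs_range[OF s i] True by simp
  qed (use f i in auto)
  then show "F (\<lambda>i. if i \<in> T then \<sigma> i else f i) = G (\<lambda>i. if i \<in> T then \<sigma> i else f i)"
    by (intro assms) blast
qed

lemma dual_add: "dual n (\<lambda>x. F x + G x) = dual n F + dual n G"
  by (simp add: dual_def sum.distrib add_divide_distrib ring_distribs)

lemma dual_scale: "dual n (\<lambda>x. c * F x) = c * dual n F"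
  by (simp add: dual_def sum_distrib_left mult_ac)

lemma dual_zero [simp]: "dual n (\<lambda>x. 0) = 0"
  by (simp add: dual_def)

lemma dual_sum: "dual n (\<lambda>x. \<Sum>k\<in>K. F k x) = (\<Sum>k\<in>K. dual n (F k))"
  by (induction K rule: infinite_finite_induct) (auto simp: dual_add)

text \<open>Outside \<open>T\<close> the holes are independent and uniform, so each such factor is
  replaced by its average.\<close>

lemma dual_prod:
  assumes "n \<ge> 2"
  shows "dual n (\<lambda>x. \<Prod>i\<in>{1..n}. g i (x i)) =
    (\<Sum>T\<in>Pow {1..n} - {{1..n}}. (- 1) ^ (n - 1 - card T) *
      ((\<Sum>\<sigma>\<in>bijs n (missed n T). \<Prod>i\<in>{1..n}. if i \<in> T then g i (\<sigma> i) else avg (n - 1) (g i))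
        / fact (n - 1)))"
proof -
  have *: "(\<Sum>f\<in>{1..n} \<rightarrow>\<^sub>E {1..n - 1}. \<Prod>i\<in>{1..n}. g i (if i \<in> T then \<sigma> i else f i)) =
      real (n - 1) ^ n * (\<Prod>i\<in>{1..n}. if i \<in> T then g i (\<sigma> i) else avg (n - 1) (g i))"
    (is "?l = ?r") for T \<sigma>
  proof -
    have "?l = (\<Prod>i\<in>{1..n}. \<Sum>h\<in>{1..n - 1}. g i (if i \<in> T then \<sigma> i else h))"
      by (rule prod_sum_PiE[symmetric]) auto
    \<comment> \<open>For \<open>i\<close> in \<open>T\<close> the inner summand is constant and
      also yields a factor \<open>n - 1\<close>; hence the same normalisation by the power
      \<open>n\<close> in \<open>dual\<close> for every \<open>T\<close>.\<close>
    also have "\<dots> = (\<Prod>i\<in>{1..n}. real (n - 1) * (if i \<in> T then g i (\<sigma> i) else avg (n - 1) (g i)))"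
      using assms by (intro prod.cong) (auto simp: avg_def)
    also have "\<dots> = ?r" by (simp only: prod.distrib prod_constant card_atLeastAtMost) simp
    finally show ?thesis .
  qed
  show ?thesis
    unfolding dual_def using assms by (simp only: * flip: sum_distrib_left) simp
qed

section \<open>Inclusion-exclusion over sets of pigeons\<close>

lemma sum_Pow_insert:
  assumes "a \<notin> X" "finite X"
  shows "(\<Sum>T\<in>Pow (insert a X). f T) = (\<Sum>T\<in>Pow X. f T + f (insert a T))"
proof -
  have "(\<Sum>T\<in>Pow (insert a X). f T) = (\<Sum>T\<in>Pow X. f T) + (\<Sum>T\<in>insert a ` Pow X. f T)"
    unfolding Pow_insert using assms by (intro sum.union_disjoint) auto
  also have "(\<Sum>T\<in>insert a ` Pow X. f T) = (\<Sum>T\<in>Pow X. f (insert a T))"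
    using assms by (subst sum.reindex) (auto simp: inj_on_def)
  finally show ?thesis by (simp add: sum.distrib)
qed

text \<open>Expansion of a product of differences, with \<open>Q\<close> the set of factors
  contributing \<open>u i\<close>. Taking averages for \<open>p\<close>, this is where the centring
  comes from.\<close>

lemma sum_Pow_alternating:
  fixes u p :: "'a \<Rightarrow> real"
  assumes "finite R"
  shows "(\<Sum>Q\<in>Pow R. (- 1) ^ (card R - card Q) * (\<Prod>i\<in>R. if i \<in> Q then u i else p i)) =
    (\<Prod>i\<in>R. u i - p i)"
proof -
  have "(\<Prod>i\<in>R. u i + - p i) = (\<Sum>Q\<in>Pow R. (\<Prod>i\<in>Q. u i) * (\<Prod>i\<in>R-Q. - p i))"
    by (rule prod_add) fact
  also have "\<dots> = (\<Sum>Q\<in>Pow R. (- 1) ^ (card R - card Q) * (\<Prod>i\<in>R. if i \<in> Q then u i else p i))"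
  proof (intro sum.cong refl)
    fix Q assume "Q \<in> Pow R"
    then have Q: "Q \<subseteq> R" "R \<inter> Q = Q" "R \<inter> - Q = R - Q" "finite Q"
      using assms finite_subset by auto
    show "(\<Prod>i\<in>Q. u i) * (\<Prod>i\<in>R-Q. - p i) =
      (- 1) ^ (card R - card Q) * (\<Prod>i\<in>R. if i \<in> Q then u i else p i)"
      using Q by (simp add: prod.If_cases assms prod_uminus card_Diff_subset)
  qed
  finally show ?thesis by simp
qed

text \<open>Each term has mean 1, leaving a sum of signs; over all subsets it vanishes, and the
  excluded full set accounts for the value 1.\<close>

lemma dual_one:
  assumes "n \<ge> 2"
  shows "dual n (\<lambda>x. 1) = 1"
proof -
  let ?N = "{1..n}"
  have "dual n (\<lambda>x. 1) = (\<Sum>T\<in>Pow ?N - {?N}. (- 1) ^ (n - 1 - card T) *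
      ((\<Sum>\<sigma>\<in>bijs n (missed n T). \<Prod>i = 1..n. if i \<in> T then 1 else avg (n - 1) (\<lambda>_. 1))
        / fact (n - 1)))"
    using dual_prod[OF assms, of "\<lambda>_ _. 1"] by simp
  also have "\<dots> = (\<Sum>T\<in>Pow ?N - {?N}. (- 1) ^ (n - 1 - card T))"
  proof (intro sum.cong refl)
    fix T assume "T \<in> Pow ?N - {?N}"
    note missed_in[OF this]
    then show "(- 1) ^ (n - 1 - card T) * ((\<Sum>\<sigma>\<in>bijs n (missed n T).
        \<Prod>i = 1..n. if i \<in> T then 1 else avg (n - 1) (\<lambda>_. 1)) / fact (n - 1)) =
      (- 1) ^ (n - 1 - card T)"
      using assms card_bijs[of "missed n T" n] by (simp add: avg_def cong: if_cong)
  qed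
  also have "\<dots> = (\<Sum>T\<in>Pow ?N - {?N}. - ((- 1) ^ (n - card T)))"
  proof (intro sum.cong refl)
    fix T assume T: "T \<in> Pow ?N - {?N}"
    then have "card T < card ?N" by (intro psubset_card_mono) auto
    then have "n - card T = Suc (n - 1 - card T)" by simp
    then show "(- 1) ^ (n - 1 - card T) = - ((- 1 :: real) ^ (n - card T))" by simp
  qed
  also have "\<dots> = 1 - (\<Sum>T\<in>Pow ?N. (- 1) ^ (n - card T))"
    by (simp add: sum_diff sum_negf)
  also have "(\<Sum>T\<in>Pow ?N. (- 1 :: real) ^ (n - card T)) = 0"
    using sum_Pow_alternating[of ?N "\<lambda>_. 1" "\<lambda>_. 1"] assms by simp
  finally show ?thesis by simp
qed

text \<open>The three terms come from sets \<open>T\<close> containing only \<open>a\<close>, only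
  \<open>b\<close>, or neither. A pigeon outside \<open>T\<close> hits \<open>j\<close> with
  probability \<open>1 / m\<close>, and the alternating sum over traces on \<open>R\<close> centres
  the remaining factors.\<close>

lemma dual_collision:
  fixes g :: "nat \<Rightarrow> nat \<Rightarrow> real"
  assumes n: "n \<ge> 2" and ab: "a \<in> {1..n}" "b \<in> {1..n}" "a \<noteq> b" and j: "j \<in> {1..n - 1}"
  defines "R \<equiv> {1..n} - {a, b}" and "m \<equiv> n - 1"
  defines "U \<equiv> \<lambda>\<sigma>. \<Prod>i\<in>R. g i (\<sigma> i) - avg m (g i)"
  shows "dual n (\<lambda>x. of_bool (x a = j) * of_bool (x b = j) * (\<Prod>i\<in>R. g i (x i))) =
    ((\<Sum>\<sigma>\<in>bijs n b. of_bool (\<sigma> a = j) * U \<sigma>) / m + (\<Sum>\<sigma>\<in>bijs n a. of_bool (\<sigma> b = j) * U \<sigma>) / m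
      - (\<Sum>\<sigma>\<in>bijs n a. U \<sigma>) / m\<^sup>2) / fact m"
proof -
  let ?N = "{1..n}"
  define G where "G i = (if i \<in> {a, b} then (\<lambda>h. of_bool (h = j)) else g i)" for i
  define q where "q T \<sigma> = (\<Prod>i\<in>?N. if i \<in> T then G i (\<sigma> i) else avg m (G i))" for T and \<sigma> :: "nat \<Rightarrow> nat"
  define P where "P Q \<sigma> = (\<Prod>i\<in>R. if i \<in> Q then g i (\<sigma> i) else avg m (g i))" for Q and \<sigma> :: "nat \<Rightarrow> nat"
  \<comment> \<open>The value zero at the full set lets the sum range over a power set, which can be
    split at \<open>a\<close> and \<open>b\<close>.\<close>
  define t where "t T = (if T = ?N then 0 else (- 1) ^ (m - card T) *
     ((\<Sum>\<sigma>\<in>bijs n (missed n T). q T \<sigma>) / fact m))" for T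
  define s where "s Q = (- 1 :: real) ^ (card R - card Q)" for Q :: "nat set"
  have R: "finite R" "a \<notin> R" "b \<notin> R" "a \<notin> insert b R" "insert a (insert b R) = ?N"
    using ab by (auto simp: R_def)
  have cR: "card R = n - 2"
    using ab by (simp add: R_def card_Diff_subset)
  have avg1: "avg m (\<lambda>h. of_bool (h = j)) = 1 / m"
    using j by (simp add: avg_def m_def)
  have q: "q T \<sigma> = (if a \<in> T then of_bool (\<sigma> a = j) else 1 / m) *
      (if b \<in> T then of_bool (\<sigma> b = j) else 1 / m) * P T \<sigma>" for T \<sigma>
  proof -
    have "(\<Prod>i\<in>R. if i \<in> T then G i (\<sigma> i) else avg m (G i)) = P T \<sigma>"
      unfolding P_def by (intro prod.cong) (auto simp: G_def R_def)
    then show ?thesis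
      unfolding q_def R(5)[symmetric] using R(1-4) ab avg1 by (simp add: G_def mult.assoc)
  qed
  have dual: "dual n (\<lambda>x. of_bool (x a = j) * of_bool (x b = j) * (\<Prod>i\<in>R. g i (x i))) =
      (\<Sum>T\<in>Pow ?N. t T)"
  proof -
    have "(\<Prod>i\<in>?N. G i (x i)) = of_bool (x a = j) * of_bool (x b = j) * (\<Prod>i\<in>R. g i (x i))" for x
    proof -
      have "(\<Prod>i\<in>R. G i (x i)) = (\<Prod>i\<in>R. g i (x i))"
        by (intro prod.cong) (auto simp: G_def R_def)
      then show ?thesis
        unfolding R(5)[symmetric] using R(1-4) ab by (simp add: G_def mult.assoc)
    qed
    then have "dual n (\<lambda>x. of_bool (x a = j) * of_bool (x b = j) * (\<Prod>i\<in>R. g i (x i))) =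
      (\<Sum>T\<in>Pow ?N - {?N}. t T)"
      using dual_prod[OF n, of G] by (simp add: t_def q_def m_def cong: if_cong)
    also have "\<dots> = (\<Sum>T\<in>Pow ?N. t T)"
      by (intro sum.mono_neutral_left) (auto simp: t_def)
    finally show ?thesis .
  qed
  have Psub: "P (insert a Q) \<sigma> = P Q \<sigma>" "P (insert b Q) \<sigma> = P Q \<sigma>" for Q \<sigma>
    unfolding P_def using R by (auto intro!: prod.cong)
  have Pcong: "P Q \<sigma> = P Q \<tau>" if "\<And>i. i \<noteq> a \<Longrightarrow> i \<noteq> b \<Longrightarrow> \<sigma> i = \<tau> i" for Q \<sigma> \<tau>
    unfolding P_def using R that by (intro prod.cong) (auto simp: R_def)
  have Pcong': "P Q \<sigma> = P Q \<tau>" if "\<And>i. i \<in> Q \<Longrightarrow> \<sigma> i = \<tau> i" for Q \<sigma> \<tau>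
    unfolding P_def using that by (intro prod.cong) auto
  \<comment> \<open>Group the subsets of \<open>{1..n}\<close> by their trace \<open>Q\<close> on \<open>R\<close>. No injection can map both \<open>a\<close>
    and \<open>b\<close> to \<open>j\<close>, so the excluded set \<open>T = {1..n}\<close> needs no separate treatment.\<close>
  have summand: "t Q + t (insert b Q) + (t (insert a Q) + t (insert a (insert b Q))) =
      ((\<Sum>\<sigma>\<in>bijs n b. of_bool (\<sigma> a = j) * (s Q * P Q \<sigma>)) / m
        + (\<Sum>\<sigma>\<in>bijs n a. of_bool (\<sigma> b = j) * (s Q * P Q \<sigma>)) / m
        - (\<Sum>\<sigma>\<in>bijs n a. s Q * P Q \<sigma>) / m\<^sup>2) / fact m"
    if Q: "Q \<in> Pow R" for Q
  proof -
    have Q': "Q \<subseteq> R" "a \<notin> Q" "b \<notin> Q" "finite Q"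
      using Q R finite_subset by auto
    have cQ: "card Q \<le> n - 2" using Q' R cR card_mono by metis
    have "t (insert a (insert b Q)) = 0"
    proof (cases "insert a (insert b Q) = ?N")
      case False
      have "q (insert a (insert b Q)) \<sigma> = 0" if "\<sigma> \<in> bijs n e" for \<sigma> e
      proof -
        have "inj \<sigma>" using that by (auto simp: bijs_def intro: permutes_inj)
        then have "\<sigma> a \<noteq> \<sigma> b" using ab by (auto dest: injD)
        then show ?thesis by (auto simp: q)
      qed
      then show ?thesis by (simp add: t_def)
    qed (simp add: t_def)
    moreover have "t (insert a Q) = (\<Sum>\<sigma>\<in>bijs n b. of_bool (\<sigma> a = j) * (s Q * P Q \<sigma>)) / m / fact m"
    proof -
      have ne: "insert a Q \<noteq> ?N" using ab Q' by auto
      then have e: "missed n (insert a Q) \<in> ?N - insert a Q"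
        using Q' ab by (intro missed_in) (auto simp: R_def)
      \<comment> \<open>\<open>b\<close> lies outside \<open>insert a Q\<close>, so it can replace
        the chosen omitted pigeon.\<close>
      have "(\<Sum>\<sigma>\<in>bijs n (missed n (insert a Q)). q (insert a Q) \<sigma>) =
          (\<Sum>\<sigma>\<in>bijs n b. q (insert a Q) \<sigma>)"
      proof (rule sum_bijs_cong)
        fix \<sigma> \<tau> :: "nat \<Rightarrow> nat"
        assume h: "\<And>i. i \<noteq> b \<Longrightarrow> i \<noteq> missed n (insert a Q) \<Longrightarrow> \<sigma> i = \<tau> i"
        have "\<sigma> i = \<tau> i" if "i \<in> insert a Q" for i
          using that e Q' ab by (intro h) auto
        then show "q (insert a Q) \<sigma> = q (insert a Q) \<tau>"
          using Pcong'[of Q \<sigma> \<tau>] ab Q' by (simp add: q Psub)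
      qed (use ab e in auto)
      also have "\<dots> = (\<Sum>\<sigma>\<in>bijs n b. of_bool (\<sigma> a = j) * P Q \<sigma>) / m"
        unfolding sum_divide_distrib using ab Q' by (intro sum.cong refl) (simp add: q Psub)
      finally have *: "(\<Sum>\<sigma>\<in>bijs n (missed n (insert a Q)). q (insert a Q) \<sigma>) =
          (\<Sum>\<sigma>\<in>bijs n b. of_bool (\<sigma> a = j) * P Q \<sigma>) / m" .
      have "(\<Sum>\<sigma>\<in>bijs n b. of_bool (\<sigma> a = j) * (s Q * P Q \<sigma>)) =
          s Q * (\<Sum>\<sigma>\<in>bijs n b. of_bool (\<sigma> a = j) * P Q \<sigma>)"
        by (simp only: sum_distrib_left mult.left_commute)
      \<comment> \<open>The pigeon added to \<open>Q\<close> makes up for \<open>card R\<close>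
        being \<open>m - 1\<close>, so the sign is exactly \<open>s Q\<close>.\<close>
      moreover have "m - card (insert a Q) = card R - card Q"
        using Q' cR by (simp add: m_def)
      ultimately show ?thesis
        using ne by (simp only: t_def * s_def) simp
    qed
    moreover have "t (insert b Q) = (\<Sum>\<sigma>\<in>bijs n a. of_bool (\<sigma> b = j) * (s Q * P Q \<sigma>)) / m / fact m"
    proof -
      have ne: "insert b Q \<noteq> ?N" using ab Q' by auto
      then have e: "missed n (insert b Q) \<in> ?N - insert b Q"
        using Q' ab by (intro missed_in) (auto simp: R_def)
      have "(\<Sum>\<sigma>\<in>bijs n (missed n (insert b Q)). q (insert b Q) \<sigma>) =
          (\<Sum>\<sigma>\<in>bijs n a. q (insert b Q) \<sigma>)"
      proof (rule sum_bijs_cong)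
        fix \<sigma> \<tau> :: "nat \<Rightarrow> nat"
        assume h: "\<And>i. i \<noteq> a \<Longrightarrow> i \<noteq> missed n (insert b Q) \<Longrightarrow> \<sigma> i = \<tau> i"
        have "\<sigma> i = \<tau> i" if "i \<in> insert b Q" for i
          using that e Q' ab by (intro h) auto
        then show "q (insert b Q) \<sigma> = q (insert b Q) \<tau>"
          using Pcong'[of Q \<sigma> \<tau>] ab Q' by (simp add: q Psub)
      qed (use ab e in auto)
      also have "\<dots> = (\<Sum>\<sigma>\<in>bijs n a. of_bool (\<sigma> b = j) * P Q \<sigma>) / m"
        unfolding sum_divide_distrib using ab Q' by (intro sum.cong refl) (simp add: q Psub)
      finally have *: "(\<Sum>\<sigma>\<in>bijs n (missed n (insert b Q)). q (insert b Q) \<sigma>) =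
          (\<Sum>\<sigma>\<in>bijs n a. of_bool (\<sigma> b = j) * P Q \<sigma>) / m" .
      have "(\<Sum>\<sigma>\<in>bijs n a. of_bool (\<sigma> b = j) * (s Q * P Q \<sigma>)) =
          s Q * (\<Sum>\<sigma>\<in>bijs n a. of_bool (\<sigma> b = j) * P Q \<sigma>)"
        by (simp only: sum_distrib_left mult.left_commute)
      moreover have "m - card (insert b Q) = card R - card Q"
        using Q' cR by (simp add: m_def)
      ultimately show ?thesis
        using ne by (simp only: t_def * s_def) simp
    qed
    moreover have "t Q = - ((\<Sum>\<sigma>\<in>bijs n a. s Q * P Q \<sigma>) / m\<^sup>2 / fact m)"
    proof -
      have ne: "Q \<noteq> ?N" using ab Q' by auto
      then have e: "missed n Q \<in> ?N - Q"
        using Q' by (intro missed_in) (auto simp: R_def)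
      have "(\<Sum>\<sigma>\<in>bijs n (missed n Q). q Q \<sigma>) = (\<Sum>\<sigma>\<in>bijs n a. q Q \<sigma>)"
      proof (rule sum_bijs_cong)
        fix \<sigma> \<tau> :: "nat \<Rightarrow> nat"
        assume h: "\<And>i. i \<noteq> a \<Longrightarrow> i \<noteq> missed n Q \<Longrightarrow> \<sigma> i = \<tau> i"
        have "\<sigma> i = \<tau> i" if "i \<in> Q" for i
          using that e Q' ab by (intro h) auto
        then show "q Q \<sigma> = q Q \<tau>"
          using Pcong'[of Q \<sigma> \<tau>] Q' by (simp add: q)
      qed (use ab e in auto)
      also have "\<dots> = (\<Sum>\<sigma>\<in>bijs n a. P Q \<sigma>) / m\<^sup>2"
        using Q' by (simp add: q sum_divide_distrib power2_eq_square)
      finally have *: "(\<Sum>\<sigma>\<in>bijs n (missed n Q). q Q \<sigma>) = (\<Sum>\<sigma>\<in>bijs n a. P Q \<sigma>) / m\<^sup>2" .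
      \<comment> \<open>With neither \<open>a\<close> nor \<open>b\<close> in \<open>T\<close> the
        exponent is one larger, whence the minus sign.\<close>
      have "m - card Q = Suc (card R - card Q)"
        using cQ n cR by (simp add: m_def)
      then show ?thesis
        using ne by (simp add: t_def * s_def flip: sum_distrib_left)
    qed
    ultimately show ?thesis
      by (simp add: add_divide_distrib diff_divide_distrib)
  qed
  have U: "U \<sigma> = (\<Sum>Q\<in>Pow R. s Q * P Q \<sigma>)" for \<sigma>
    unfolding U_def s_def P_def using R by (subst sum_Pow_alternating) auto
  have "(\<Sum>T\<in>Pow ?N. t T) =
      (\<Sum>Q\<in>Pow R. t Q + t (insert b Q) + (t (insert a Q) + t (insert a (insert b Q))))"
    unfolding R(5)[symmetric] using R(1-4)
    by (simp add: sum_Pow_insert sum.distrib)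
  also have "\<dots> = (\<Sum>Q\<in>Pow R. ((\<Sum>\<sigma>\<in>bijs n b. of_bool (\<sigma> a = j) * (s Q * P Q \<sigma>)) / m
        + (\<Sum>\<sigma>\<in>bijs n a. of_bool (\<sigma> b = j) * (s Q * P Q \<sigma>)) / m
        - (\<Sum>\<sigma>\<in>bijs n a. s Q * P Q \<sigma>) / m\<^sup>2) / fact m)"
    by (intro sum.cong refl summand)
  also have "\<dots> = ((\<Sum>Q\<in>Pow R. \<Sum>\<sigma>\<in>bijs n b. of_bool (\<sigma> a = j) * (s Q * P Q \<sigma>)) / m
        + (\<Sum>Q\<in>Pow R. \<Sum>\<sigma>\<in>bijs n a. of_bool (\<sigma> b = j) * (s Q * P Q \<sigma>)) / m
        - (\<Sum>Q\<in>Pow R. \<Sum>\<sigma>\<in>bijs n a. s Q * P Q \<sigma>) / m\<^sup>2) / fact m"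
    by (simp only: sum.distrib sum_subtractf flip: sum_divide_distrib)
  also have "\<dots> = ((\<Sum>\<sigma>\<in>bijs n b. of_bool (\<sigma> a = j) * U \<sigma>) / m
      + (\<Sum>\<sigma>\<in>bijs n a. of_bool (\<sigma> b = j) * U \<sigma>) / m - (\<Sum>\<sigma>\<in>bijs n a. U \<sigma>) / m\<^sup>2) / fact m"
    unfolding U sum_distrib_left by (simp only: sum.swap[of _ _ "Pow R"])
  finally show ?thesis unfolding dual .
qed

section \<open>Second-moment estimates\<close>

text \<open>This is \<open>m\<close> times a variance. Values in \<open>[0, 1]\<close> dominate
  their squares, which leaves \<open>p - p^2\<close>, at most \<open>1 / 4\<close>.\<close>

lemma sum_centered_squares_le:
  assumes "\<And>h. g h \<in> {0..1::real}"
  shows "(\<Sum>h=1..m. (g h - avg m g)\<^sup>2) \<le> m / 4"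
proof (cases "m = 0")
  case False
  define p where "p = avg m g"
  have S: "(\<Sum>h=1..m. g h) = m * p" using False by (simp add: p_def avg_def)
  have "(\<Sum>h=1..m. (g h - p)\<^sup>2) \<le> (\<Sum>h=1..m. g h - 2 * p * g h + p\<^sup>2)"
  proof (intro sum_mono)
    fix h
    have "g h * g h \<le> g h * 1" using assms[of h] by (intro mult_left_mono) auto
    then show "(g h - p)\<^sup>2 \<le> g h - 2 * p * g h + p\<^sup>2"
      by (simp add: power2_eq_square algebra_simps)
  qed
  also have "\<dots> = m * (p - p\<^sup>2)"
    unfolding sum.distrib sum_subtractf sum_distrib_left[symmetric] S
    by (simp add: power2_eq_square algebra_simps)
  also have "\<dots> \<le> m * (1 / 4)"
  proof (intro mult_left_mono)
    have "0 \<le> (p - 1 / 2)\<^sup>2" by simp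
    then show "p - p\<^sup>2 \<le> 1 / 4" by (simp add: power2_eq_square algebra_simps)
  qed simp
  finally show ?thesis by (simp add: p_def)
qed simp

text \<open>The pigeon \<open>b\<close> is free on the right-hand side, which costs the factor \<open>n - 1\<close>.\<close>

lemma sum_bijs_le:
  fixes u :: "nat \<Rightarrow> nat \<Rightarrow> real"
  assumes ab: "a \<in> {1..n}" "b \<in> {1..n}" "a \<noteq> b"
    and nonneg: "\<And>i h. u i h \<ge> 0"
  shows "(\<Sum>\<sigma>\<in>bijs n a. \<Prod>i\<in>{1..n}-{a,b}. u i (\<sigma> i)) \<le>
    real (n - 1) * (\<Prod>i\<in>{1..n}-{a,b}. \<Sum>h=1..n - 1. u i h)"
proof -
  let ?A = "{1..n} - {a}" and ?R = "{1..n} - {a, b}"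
  \<comment> \<open>The factor 1 at \<open>b\<close> lets the product run over all pigeons but
    \<open>a\<close>, whose holes determine an element of \<open>bijs n a\<close>.\<close>
  define v where "v i h = (if i = b then 1 else u i h)" for i h
  have v0: "v i h \<ge> 0" for i h using nonneg by (simp add: v_def)
  have A: "?A = insert b ?R" using ab by auto
  have v: "(\<Prod>i\<in>?A. v i (x i)) = (\<Prod>i\<in>?R. u i (x i))" for x
    unfolding A by (auto simp: v_def intro!: prod.cong)
  have inj: "inj_on (\<lambda>\<sigma>. restrict \<sigma> ?A) (bijs n a)"
  proof (rule inj_onI)
    fix \<sigma> \<tau> assume st: "\<sigma> \<in> bijs n a" "\<tau> \<in> bijs n a" "restrict \<sigma> ?A = restrict \<tau> ?A"
    show "\<sigma> = \<tau>"
    proof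
      fix i
      consider "i = a" | "i \<in> ?A" | "i \<notin> {1..n}" by auto
      then show "\<sigma> i = \<tau> i"
      proof cases
        case 1
        then show ?thesis using st by (simp add: bijs_def)
      next
        case 2
        then show ?thesis using st(3) by (metis restrict_apply')
      next
        case 3
        have "\<sigma> permutes {1..n}" "\<tau> permutes {1..n}" using st by (simp_all add: bijs_def)
        then show ?thesis using 3 by (metis permutes_not_in)
      qed
    qed
  qed
  have "(\<Sum>\<sigma>\<in>bijs n a. \<Prod>i\<in>?R. u i (\<sigma> i)) = (\<Sum>\<sigma>\<in>bijs n a. \<Prod>i\<in>?A. v i (restrict \<sigma> ?A i))"
    unfolding v by (intro sum.cong prod.cong refl) auto
  also have "\<dots> = (\<Sum>f\<in>(\<lambda>\<sigma>. restrict \<sigma> ?A) ` bijs n a. \<Prod>i\<in>?A. v i (f i))"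
    using inj by (simp add: sum.reindex)
  \<comment> \<open>All terms are nonnegative, so the sum may be enlarged from bijections to
    arbitrary maps, where it factors.\<close>
  also have "\<dots> \<le> (\<Sum>f\<in>?A \<rightarrow>\<^sub>E {1..n - 1}. \<Prod>i\<in>?A. v i (f i))"
  proof (intro sum_mono2)
    show "(\<lambda>\<sigma>. restrict \<sigma> ?A) ` bijs n a \<subseteq> ?A \<rightarrow>\<^sub>E {1..n - 1}"
    proof (intro image_subsetI restrict_PiE_iff[THEN iffD2] ballI)
      fix \<sigma> i assume "\<sigma> \<in> bijs n a" "i \<in> ?A"
      then show "\<sigma> i \<in> {1..n - 1}" by (intro bijs_range) auto
    qed
  qed (auto intro!: finite_PiE prod_nonneg simp: v0)
  also have "\<dots> = (\<Prod>i\<in>?A. \<Sum>h=1..n - 1. v i h)"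
    by (rule prod_sum_PiE[symmetric]) auto
  also have "\<dots> = real (n - 1) * (\<Prod>i\<in>?R. \<Sum>h=1..n - 1. u i h)"
  proof -
    have "(\<Prod>i\<in>?R. \<Sum>h=1..n - 1. v i h) = (\<Prod>i\<in>?R. \<Sum>h=1..n - 1. u i h)"
      by (intro prod.cong sum.cong) (auto simp: v_def)
    moreover have "(\<Sum>h=1..n - 1. v b h) = real (n - 1)" by (simp add: v_def)
    ultimately show ?thesis unfolding A by (subst prod.insert) auto
  qed
  finally show ?thesis .
qed

text \<open>After division by \<open>fact m\<close>, the left-hand side is a single term of the
  exponential series at \<open>m\<close>.\<close>

lemma power_self_le_exp_fact: "real m ^ m \<le> exp (real m) * fact m"
proof -
  have "real m ^ m / fact m \<le> exp (real m)"
  proof -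
    have "(\<Sum>k\<in>{m}. real m ^ k /\<^sub>R fact k) \<le> suminf (\<lambda>k. real m ^ k /\<^sub>R fact k)"
      by (intro sum_le_suminf summable_exp_generic) auto
    then show ?thesis by (simp add: exp_def field_simps)
  qed
  then show ?thesis by (simp add: field_simps)
qed

text \<open>Bounds the three terms of \<open>dual_collision\<close>, each by
  \<open>2 / m * (sqrt (exp 1) / 2) ^ m\<close>.\<close>

definition collision_bound :: "nat \<Rightarrow> real" where
  "collision_bound m = 6 / m * (sqrt (exp 1) / 2) ^ m"

text \<open>Cauchy-Schwarz against the constant 1 on the \<open>fact m\<close> bijections passes to
  squares, to which \<open>sum_bijs_le\<close> and the variance bound apply.\<close>

lemma sum_bijs_centered_le:
  fixes g :: "nat \<Rightarrow> nat \<Rightarrow> real"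
  assumes n: "n \<ge> 2" and ab: "a \<in> {1..n}" "b \<in> {1..n}" "a \<noteq> b"
    and g: "\<And>i h. g i h \<in> {0..1}"
  defines "m \<equiv> n - 1"
  shows "(\<Sum>\<sigma>\<in>bijs n a. \<bar>\<Prod>i\<in>{1..n}-{a,b}. g i (\<sigma> i) - avg m (g i)\<bar>) \<le>
    2 * (sqrt (exp 1) / 2) ^ m * fact m"
proof -
  let ?R = "{1..n} - {a, b}"
  let ?U = "\<lambda>\<sigma>. \<Prod>i\<in>?R. g i (\<sigma> i) - avg m (g i)"
  have m: "m \<ge> 1" using n by (simp add: m_def)
  have cR: "card ?R = m - 1" using ab by (simp add: card_Diff_subset m_def)
  have "(\<Sum>\<sigma>\<in>bijs n a. \<bar>?U \<sigma>\<bar>)\<^sup>2 \<le> fact m * (\<Sum>\<sigma>\<in>bijs n a. \<bar>?U \<sigma>\<bar>\<^sup>2)"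
    using sum_squared_le_sum_of_squares[of "\<lambda>\<sigma>. \<bar>?U \<sigma>\<bar>" "bijs n a"] card_bijs[of a n] ab
    by (simp add: m_def mult.commute)
  also have "(\<Sum>\<sigma>\<in>bijs n a. \<bar>?U \<sigma>\<bar>\<^sup>2) = (\<Sum>\<sigma>\<in>bijs n a. \<Prod>i\<in>?R. (g i (\<sigma> i) - avg m (g i))\<^sup>2)"
    by (simp add: prod_power_distrib)
  also have "\<dots> \<le> m * (\<Prod>i\<in>?R. \<Sum>h=1..m. (g i h - avg m (g i))\<^sup>2)"
    unfolding m_def by (rule sum_bijs_le) (use ab in auto)
  also have "\<dots> \<le> m * (\<Prod>i\<in>?R. real m / 4)"
    by (intro mult_left_mono prod_mono conjI sum_nonneg sum_centered_squares_le g) auto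
  \<comment> \<open>Only \<open>m - 1\<close> factors \<open>m / 4\<close> are present; completing
    the power costs 4, which becomes 2 under the square root.\<close>
  also have "\<dots> = 4 * (real m ^ m / 4 ^ m)"
    using m cR by (cases m) (simp_all add: power_divide)
  also have "\<dots> \<le> 4 * (exp (real m) * fact m / 4 ^ m)"
    by (intro mult_left_mono divide_right_mono power_self_le_exp_fact) auto
  also have "fact m * \<dots> = (2 * (sqrt (exp 1) / 2) ^ m * fact m)\<^sup>2"
  proof -
    have "((sqrt (exp 1) / 2) ^ m)\<^sup>2 = ((sqrt (exp 1) / 2)\<^sup>2) ^ m"
      by (simp only: mult.commute[of m] flip: power_mult)
    also have "\<dots> = exp (real m) / 4 ^ m"
      by (simp add: power_divide flip: exp_of_nat_mult)
    finally show ?thesis by (simp add: power_mult_distrib power2_eq_square[of "fact m"])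
  qed
  finally show ?thesis
    by (rule power2_le_imp_le) auto
qed

lemma dual_collision_le:
  fixes g :: "nat \<Rightarrow> nat \<Rightarrow> real"
  assumes n: "n \<ge> 2" and ab: "a \<in> {1..n}" "b \<in> {1..n}" "a \<noteq> b" and j: "j \<in> {1..n - 1}"
    and g: "\<And>i h. g i h \<in> {0..1}"
  shows "\<bar>dual n (\<lambda>x. of_bool (x a = j) * of_bool (x b = j) * (\<Prod>i\<in>{1..n}-{a,b}. g i (x i)))\<bar>
    \<le> collision_bound (n - 1)"
proof -
  define m where "m = n - 1"
  define X where "X = 2 * (sqrt (exp 1) / 2) ^ m * (fact m :: real)"
  let ?U = "\<lambda>\<sigma>. \<Prod>i\<in>{1..n}-{a,b}. g i (\<sigma> i) - avg m (g i)"
  let ?D = "\<lambda>e c. \<Sum>\<sigma>\<in>bijs n e. of_bool (\<sigma> c = j) * ?U \<sigma>"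
  have m: "real m \<ge> 1" using n by (simp add: m_def)
  have X: "(\<Sum>\<sigma>\<in>bijs n a. \<bar>?U \<sigma>\<bar>) \<le> X" "(\<Sum>\<sigma>\<in>bijs n b. \<bar>?U \<sigma>\<bar>) \<le> X"
    unfolding X_def m_def
    using sum_bijs_centered_le[OF n ab, of g] sum_bijs_centered_le[OF n ab(2,1) ab(3)[symmetric], of g] g
    by (auto simp: insert_commute)
  have X0: "X \<ge> 0" by (simp add: X_def)
  \<comment> \<open>The indicator of \<open>\<sigma> c = j\<close> is at most 1 and is
    dropped.\<close>
  have D: "\<bar>?D e c\<bar> \<le> (\<Sum>\<sigma>\<in>bijs n e. \<bar>?U \<sigma>\<bar>)" for e c
    by (rule order_trans[OF sum_abs]) (intro sum_mono, simp)
  have E: "\<bar>\<Sum>\<sigma>\<in>bijs n a. ?U \<sigma>\<bar> \<le> (\<Sum>\<sigma>\<in>bijs n a. \<bar>?U \<sigma>\<bar>)"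
    by (rule sum_abs)
  have 1: "\<bar>?D b a / m\<bar> \<le> X / m" "\<bar>?D a b / m\<bar> \<le> X / m"
    unfolding abs_divide using D[of b a] D[of a b] X m by (auto intro!: divide_right_mono)
  have 2: "\<bar>(\<Sum>\<sigma>\<in>bijs n a. ?U \<sigma>) / m\<^sup>2\<bar> \<le> X / m"
  proof -
    have "m \<le> m\<^sup>2" using m by (simp add: power2_eq_square)
    then have "real m \<le> (real m)\<^sup>2" by (metis of_nat_le_iff of_nat_power)
    then show ?thesis
      unfolding abs_divide using order_trans[OF E X(1)] X0 m by (intro frac_le) auto
  qed
  have "\<bar>?D b a / m + ?D a b / m - (\<Sum>\<sigma>\<in>bijs n a. ?U \<sigma>) / m\<^sup>2\<bar> \<le> 3 * (X / m)"
    using 1 2 by linarith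
  then have "\<bar>(?D b a / m + ?D a b / m - (\<Sum>\<sigma>\<in>bijs n a. ?U \<sigma>) / m\<^sup>2) / fact m\<bar> \<le> 3 * (X / m) / fact m"
    unfolding abs_divide by (intro frac_le) auto
  also have "\<dots> = collision_bound m"
    by (simp add: X_def collision_bound_def)
  finally show ?thesis
    unfolding dual_collision[OF n ab j] m_def .
qed

subsection \<open>Pigeonhole axioms under the pseudo-distribution\<close>

text \<open>If \<open>x\<close> maps pigeons to holes, this 0/1 point satisfies the Boolean and
  pigeon axioms, so only collisions can violate the system.\<close>

definition point :: "(nat \<Rightarrow> nat) \<Rightarrow> nat \<times> nat \<Rightarrow> real" where
  "point x = (\<lambda>(i, h). of_bool (x i = h))"

lemma prod_of_bool:
  "finite A \<Longrightarrow> (\<Prod>a\<in>A. of_bool (P a) :: real) = of_bool (\<forall>a\<in>A. P a)"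
  by (induction A rule: finite_induct) auto

lemma eval_poly_bool_monomial:
  assumes "finite S" "finite T"
  shows "eval_poly (point x) (bool_monomial (S, T)) =
    of_bool ((\<forall>(i, h)\<in>S. x i = h) \<and> (\<forall>(i, h)\<in>T. x i \<noteq> h))"
proof -
  have "eval_poly (point x) (bool_monomial (S, T)) =
      (\<Prod>v\<in>S. of_bool (x (fst v) = snd v)) * (\<Prod>v\<in>T. of_bool (x (fst v) \<noteq> snd v))"
    by (simp add: bool_monomial_def eval_poly_mult eval_poly_prod eval_poly_diff point_def
        case_prod_beta of_bool_not_iff)
  then show ?thesis
    using assms by (simp add: prod_of_bool case_prod_beta)
qed

text \<open>A monomial is a conjunction of conditions on single pigeons, so at
  \<open>point x\<close> it factors over the pigeons as \<open>dual_collision_le\<close>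
  requires.\<close>

lemma abs_dual_hole_le:
  assumes n: "n \<ge> 2" and ab: "a \<in> {1..n}" "b \<in> {1..n}" "a \<noteq> b" and j: "j \<in> {1..n - 1}"
    and r: "r \<in> monomial_shapes (php_vars n)"
  shows "\<bar>dual n (\<lambda>x. eval_poly (point x) (php_axiom n (Hole a b j) * bool_monomial r))\<bar> \<le> collision_bound (n - 1)"
proof -
  obtain S T where ST: "r = (S, T)" "S \<subseteq> php_vars n" "T \<subseteq> php_vars n"
    using r by (auto simp: monomial_shapes_def)
  then have fin: "finite S" "finite T" using finite_php_vars finite_subset by blast+
  define ok where "ok i h \<longleftrightarrow> (\<forall>v\<in>S. fst v = i \<longrightarrow> h = snd v) \<and> (\<forall>v\<in>T. fst v = i \<longrightarrow> h \<noteq> snd v)" for i h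
  \<comment> \<open>The collision fixes \<open>a\<close> and \<open>b\<close> at \<open>j\<close>,
    so their conditions become a constant 0 or 1.\<close>
  define \<kappa> :: real where "\<kappa> = of_bool (ok a j \<and> ok b j)"
  let ?R = "{1..n} - {a, b}"
  let ?F = "\<lambda>x :: nat \<Rightarrow> nat. of_bool (x a = j) * of_bool (x b = j) * (\<Prod>i\<in>?R. of_bool (ok i (x i)) :: real)"
  have "eval_poly (point x) (php_axiom n (Hole a b j) * bool_monomial r) = \<kappa> * ?F x" for x
  proof -
    have N: "{1..n} = insert a (insert b ?R)" using ab by auto
    have "(\<forall>(i, h)\<in>S. x i = h) \<and> (\<forall>(i, h)\<in>T. x i \<noteq> h) \<longleftrightarrow> (\<forall>i\<in>{1..n}. ok i (x i))"
      using ST(2,3) by (fastforce simp: ok_def php_vars_def)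
    also have "\<dots> \<longleftrightarrow> ok a (x a) \<and> ok b (x b) \<and> (\<forall>i\<in>?R. ok i (x i))"
      by (subst N) blast
    finally have "eval_poly (point x) (bool_monomial r) =
        of_bool (ok a (x a) \<and> ok b (x b) \<and> (\<forall>i\<in>?R. ok i (x i)))"
      unfolding ST(1) eval_poly_bool_monomial[OF fin] by simp
    then show ?thesis
      by (auto simp: eval_poly_mult point_def \<kappa>_def prod_of_bool)
  qed
  then have "dual n (\<lambda>x. eval_poly (point x) (php_axiom n (Hole a b j) * bool_monomial r)) = \<kappa> * dual n ?F"
    by (simp only: dual_scale)
  moreover have "\<bar>dual n ?F\<bar> \<le> collision_bound (n - 1)"
    by (rule dual_collision_le[OF n ab j]) simp
  ultimately show ?thesis
    by (auto simp: \<kappa>_def collision_bound_def)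
qed

text \<open>On an assignment to holes, the factor with \<open>j = x i\<close> is zero.\<close>

lemma dual_pigeon:
  assumes "i \<in> {1..n}"
  shows "dual n (\<lambda>x. eval_poly (point x) (php_axiom n (Pigeon i) * q)) = 0"
proof -
  have "eval_poly (point x) (php_axiom n (Pigeon i) * q) = 0" if "x \<in> {1..n} \<rightarrow> {1..n - 1}" for x
  proof -
    have "x i \<in> {1..n - 1}" using that assms by auto
    then have "(\<Prod>j=1..n - 1. 1 - point x (i, j)) = 0"
      by (intro prod_zero) (auto simp: point_def)
    then show ?thesis by (simp add: eval_poly_mult eval_poly_prod eval_poly_diff)
  qed
  then have "dual n (\<lambda>x. eval_poly (point x) (php_axiom n (Pigeon i) * q)) = dual n (\<lambda>x. 0)"
    by (rule dual_cong)
  then show ?thesis by simp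
qed

section \<open>Weak duality and the lower bound\<close>

text \<open>Apply \<open>dual\<close> to the refutation evaluated at the points
  \<open>point x\<close>: the left side gives 1, the Boolean part vanishes, and each coefficient is
  weighted by at most \<open>collision_bound (n - 1)\<close>.\<close>

lemma one_le_bound_total_coeff_size:
  assumes n: "n \<ge> 2"
    and refutation: "nullstellensatz_proof (php_vars n) (php_indices n) (php_axiom n) C G"
  shows "1 \<le> collision_bound (n - 1) * total_coeff_size (php_vars n) (php_indices n) C"
proof -
  let ?V = "php_vars n" and ?I = "php_indices n"
  let ?M = "monomial_shapes ?V"
  let ?E = "\<lambda>k r x. eval_poly (point x) (php_axiom n k * bool_monomial r)"
  have one: "1 = (\<Sum>k\<in>?I. \<Sum>r\<in>?M. C k r * ?E k r x)" for x
  proof -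
    have bool: "eval_poly (point x) ((Var v)\<^sup>2 - Var v) = 0" for v
      by (simp add: power2_eq_square eval_poly_mult eval_poly_diff point_def case_prod_beta)
    have "1 = eval_poly (point x) 1" by simp
    also have "(1 :: (nat \<times> nat) rpoly) = (\<Sum>k\<in>?I. php_axiom n k * lin_comb ?V (C k)) +
        (\<Sum>a\<in>?V. G a * ((Var a)\<^sup>2 - Var a))"
      using refutation by (simp add: nullstellensatz_proof_def)
    also have "eval_poly (point x) \<dots> = (\<Sum>k\<in>?I. \<Sum>r\<in>?M. C k r * ?E k r x)"
      by (simp add: eval_poly_add eval_poly_sum eval_poly_mult bool lin_comb_def sum_distrib_left mult_ac)
    finally show ?thesis .
  qed
  have E: "\<bar>dual n (?E k r)\<bar> \<le> collision_bound (n - 1)" if k: "k \<in> ?I" and r: "r \<in> ?M" for k r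
  proof -
    consider i where "k = Pigeon i" "i \<in> {1..n}"
      | a b j where "k = Hole a b j" "a \<in> {1..n}" "b \<in> {1..n}" "a \<noteq> b" "j \<in> {1..n - 1}"
      using k unfolding php_indices_def by blast
    then show ?thesis
    proof cases
      case 1
      then show ?thesis by (simp only: dual_pigeon) (simp add: collision_bound_def)
    next
      case 2
      then show ?thesis using abs_dual_hole_le[OF n _ _ _ _ r] by blast
    qed
  qed
  have "1 = dual n (\<lambda>x. 1)" using dual_one[OF n] by simp
  also have "\<dots> = dual n (\<lambda>x. \<Sum>k\<in>?I. \<Sum>r\<in>?M. C k r * ?E k r x)"
    using one by simp
  also have "\<dots> = (\<Sum>k\<in>?I. \<Sum>r\<in>?M. C k r * dual n (?E k r))"
    by (simp only: dual_sum dual_scale)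
  also have "\<dots> \<le> (\<Sum>k\<in>?I. \<Sum>r\<in>?M. \<bar>C k r\<bar> * collision_bound (n - 1))"
  proof (intro sum_mono)
    fix k r assume "k \<in> ?I" "r \<in> ?M"
    then have "\<bar>C k r * dual n (?E k r)\<bar> \<le> \<bar>C k r\<bar> * collision_bound (n - 1)"
      unfolding abs_mult by (intro mult_left_mono E) auto
    then show "C k r * dual n (?E k r) \<le> \<bar>C k r\<bar> * collision_bound (n - 1)" by linarith
  qed
  also have "\<dots> = collision_bound (n - 1) * total_coeff_size ?V ?I C"
    by (simp add: total_coeff_size_def coeff_size_def sum_distrib_left mult.commute)
  finally show ?thesis .
qed

theorem theorem1:
  "\<exists>c>0. \<forall>n::nat. n \<ge> 2 \<longrightarrow>
     (\<forall>C G. nullstellensatz_proof (php_vars n) (php_indices n) (php_axiom n) C G \<longrightarrow>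
        total_coeff_size (php_vars n) (php_indices n) C
          \<ge> c * real n powr (3/4) * (2 / sqrt (exp 1)) ^ n)"
\<comment> \<open>24 is the product of 6 from \<open>collision_bound\<close>, 2 from
  \<open>n \<le> 2 * m\<close> and 2 from \<open>q \<le> 2\<close>.\<close>
proof (intro exI[of _ "1 / 24"] conjI allI impI)
  fix n :: nat and C :: "php_index \<Rightarrow> (nat \<times> nat) set \<times> (nat \<times> nat) set \<Rightarrow> real"
    and G :: "nat \<times> nat \<Rightarrow> (nat \<times> nat) rpoly"
  assume n: "2 \<le> n" and refutation: "nullstellensatz_proof (php_vars n) (php_indices n) (php_axiom n) C G"
  let ?t = "total_coeff_size (php_vars n) (php_indices n) C"
  define q :: real where "q = 2 / sqrt (exp 1)"
  obtain m where m: "n = Suc m" "m \<ge> 1" using n by (cases n) auto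
  have q: "0 < q" "q \<le> 2" by (simp_all add: q_def field_simps)
  have "collision_bound m = 6 / (m * q ^ m)"
    by (simp add: collision_bound_def q_def power_divide)
  then have "6 = (m * q ^ m) * collision_bound m" using m q by simp
  moreover have "(m * q ^ m) * 1 \<le> (m * q ^ m) * (collision_bound m * ?t)"
    using one_le_bound_total_coeff_size[OF n refutation] m q by (intro mult_left_mono) auto
  ultimately have t: "m * q ^ m / 6 \<le> ?t"
    by (simp flip: mult.assoc)
  \<comment> \<open>The bound in \<open>t\<close> is already linear in \<open>m\<close> besides the
    exponential, so the exponent \<open>3 / 4\<close> is simply raised to 1.\<close>
  have "real n powr (3 / 4) \<le> real n powr 1" using n by (intro powr_mono) auto
  also have "\<dots> \<le> 2 * m" using m by simp
  finally have "real n powr (3 / 4) * (q ^ m * q) \<le> (2 * m) * (q ^ m * 2)"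
    using q by (intro mult_mono) auto
  then show "1 / 24 * real n powr (3 / 4) * (2 / sqrt (exp 1)) ^ n \<le> ?t"
    using t m unfolding q_def[symmetric] by (simp add: mult_ac)
qed simp

end
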